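(* Let $\mathcal{C}$ be a finitely complete category that has coequalizers and in which regular epimorphisms are closed under composition, let $H\colon\mathcal{C}\to\mathcal{C}$ be a functor preserving monomorphisms, and let $(X,\xi)$ be an $H$-coalgebra. If the $\mathsf{select}$ routine is progressing, then the categorical partition refinement algorithm (described in the context) terminates and computes the simple quotient of the input coalgebra $(X,\xi)$, provided that $(X,\xi)$ has only finitely many quotients.
   Context: The kernel $\ker f$ of $f\colon X\to Y$ is its kernel pair $\ker f\rightrightarrows X$, regarded as a subobject of $X\times X$. For a kernel $R\rightrightarrows X$, $\kappa_R\colon X\twoheadrightarrow X/R$ is its coequalizer. $R$ is finer than $R'$ if $R\le R'$ as subobjects of $X\times X$; $\cap$ is intersection of subobjects. A coalgebra is a pair $(X,\xi)$ with $\xi\colon X\to HX$; a coalgebra morphism $h\colon(X,\xi)\to(Y,\zeta)$ is a morphism with $\zeta\cdot h=Hh\cdot\xi$. A quotient of a coalgebra $(X,\xi)$ is represented by a coalgebra morphism with domain $(X,\xi)$ carried by a regular epimorphism of $\mathcal{C}$ (up to isomorphism of codomains under $X$); a coalgebra is simple if every quotient of it is an isomorphism; the simple quotient of a coalgebra is a quotient with simple codomain (unique up to isomorphism). A $\mathsf{select}$ routine is an operation that receives a chain of regular epimorphisms $X\xrightarrow{y}Y\xrightarrow{z}Z$ and returns some morphism $\mathsf{select}(y,z)\colon Y\to K$. It is discarding at $(y,z)$ if $\mathsf{select}(y,z)$ factorizes through $z$; it is progressing if it is discarding at $(y,z)$ only if $z$ is an isomorphism. Algorithm (categorical partition refinement),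 for a fixed $\mathsf{select}$ routine: given $\xi\colon X\to HX$, put $Q_0=X\times X$, $\bar q_0=\,!\colon X\to 1=K_0$ (with $1$ the terminal object), $P_0=\ker(X\xrightarrow{\xi}HX\xrightarrow{H!}H1)$. Then iterate for $i=0,1,2,\dots$ while $P_i$ is properly finer than $Q_i$: (1) $q_{i+1}=\mathsf{select}(\kappa_{P_i},f_i)\cdot\kappa_{P_i}\colon X\to K_{i+1}$, where $f_i\colon X/P_i\twoheadrightarrow X/Q_i$ is the unique morphism with $f_i\cdot\kappa_{P_i}=\kappa_{Q_i}$ (it exists because $P_i$ is always finer than $Q_i$), and $\bar q_{i+1}=\langle\bar q_i,q_{i+1}\rangle\colon X\to\prod_{j\le i+1}K_j$; (2) $Q_{i+1}=\ker\bar q_{i+1}=Q_i\cap\ker q_{i+1}$; (3) $P_{i+1}=\ker(X\xrightarrow{\xi}HX\xrightarrow{H\bar q_{i+1}}H\prod_{j\le i+1}K_j)$. Upon termination (i.e. when $P_i=Q_i$) return $X/P_i=X/Q_i$. If $P_i=Q_i$, then $X/Q_i$ carries a unique coalgebra structure making $\kappa_{Q_i}$ a coalgebra morphism; computing the simple quotient means that $\kappa_{Q_i}$ with this structure represents the simple quotient of $(X,\xi)$.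
   Formalization: "Has only finitely many quotients" is taken to mean that the carrier object X has finitely many regular quotients; with only finitely many coalgebra quotients termination fails (Set, HY = 2×Y, ξ(n) = (n=0, max(n−1,0)) on the naturals, select = id). *)

theory Defs
  imports Main
begin

section \<open>Categories, functors and finite limits\<close>

record ('o, 'm) cat =
  Obj :: "'o set"
  Arr :: "'m set"
  Dom :: "'m \<Rightarrow> 'o"
  Cod :: "'m \<Rightarrow> 'o"
  Ident :: "'o \<Rightarrow> 'm"
  Comp :: "'m \<Rightarrow> 'm \<Rightarrow> 'm"  (infixl "\<cdot>\<index>" 70)

definition in_hom :: "('o, 'm) cat \<Rightarrow> 'm \<Rightarrow> 'o \<Rightarrow> 'o \<Rightarrow> bool" where
  "in_hom C f A B \<longleftrightarrow> f \<in> Arr C \<and> Dom C f = A \<and> Cod C f = B"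

locale category =
  fixes C :: "('o, 'm) cat" (structure)
  assumes dom_in_Obj: "f \<in> Arr C \<Longrightarrow> Dom C f \<in> Obj C"
    and cod_in_Obj: "f \<in> Arr C \<Longrightarrow> Cod C f \<in> Obj C"
    and ident_in_hom: "A \<in> Obj C \<Longrightarrow> in_hom C (Ident C A) A A"
    and comp_in_hom: "in_hom C f A B \<Longrightarrow> in_hom C g B D \<Longrightarrow> in_hom C (g \<cdot> f) A D"
    and comp_ident_right: "in_hom C f A B \<Longrightarrow> f \<cdot> Ident C A = f"
    and comp_ident_left: "in_hom C f A B \<Longrightarrow> Ident C B \<cdot> f = f"
    and comp_assoc:
      "in_hom C f A B \<Longrightarrow> in_hom C g B D \<Longrightarrow> in_hom C h D E \<Longrightarrow> (h \<cdot> g) \<cdot> f = h \<cdot> (g \<cdot> f)"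

record ('o1, 'm1, 'o2, 'm2) ftor =
  FObj :: "'o1 \<Rightarrow> 'o2"
  FArr :: "'m1 \<Rightarrow> 'm2"

definition is_functor ::
  "('o1, 'm1) cat \<Rightarrow> ('o2, 'm2) cat \<Rightarrow> ('o1, 'm1, 'o2, 'm2) ftor \<Rightarrow> bool" where
  "is_functor A B F \<longleftrightarrow>
     (\<forall>X\<in>Obj A. FObj F X \<in> Obj B) \<and>
     (\<forall>f X Y. in_hom A f X Y \<longrightarrow> in_hom B (FArr F f) (FObj F X) (FObj F Y)) \<and>
     (\<forall>X\<in>Obj A. FArr F (Ident A X) = Ident B (FObj F X)) \<and>
     (\<forall>f g X Y Z. in_hom A f X Y \<longrightarrow> in_hom A g Y Z \<longrightarrow>
        FArr F (g \<cdot>\<^bsub>A\<^esub> f) = FArr F g \<cdot>\<^bsub>B\<^esub> FArr F f)"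

definition is_cone ::
  "('j, 'u) cat \<Rightarrow> ('o, 'm) cat \<Rightarrow> ('j, 'u, 'o, 'm) ftor \<Rightarrow> 'o \<Rightarrow> ('j \<Rightarrow> 'm) \<Rightarrow> bool" where
  "is_cone J C D L p \<longleftrightarrow>
     L \<in> Obj C \<and>
     (\<forall>j\<in>Obj J. in_hom C (p j) L (FObj D j)) \<and>
     (\<forall>u j k. in_hom J u j k \<longrightarrow> FArr D u \<cdot>\<^bsub>C\<^esub> p j = p k)"

definition is_limit ::
  "('j, 'u) cat \<Rightarrow> ('o, 'm) cat \<Rightarrow> ('j, 'u, 'o, 'm) ftor \<Rightarrow> 'o \<Rightarrow> ('j \<Rightarrow> 'm) \<Rightarrow> bool" where
  "is_limit J C D L p \<longleftrightarrow>
     is_cone J C D L p \<and>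
     (\<forall>A t. is_cone J C D A t \<longrightarrow>
        (\<exists>!m. in_hom C m A L \<and> (\<forall>j\<in>Obj J. p j \<cdot>\<^bsub>C\<^esub> m = t j)))"

text \<open>Index categories range over the finite categories with objects and morphisms in \<^typ>\<open>nat\<close>;
  every finite category is isomorphic to one of these.\<close>

definition finitely_complete :: "('o, 'm) cat \<Rightarrow> bool" where
  "finitely_complete C \<longleftrightarrow>
     (\<forall>(J :: (nat, nat) cat) D.
        category J \<longrightarrow> finite (Obj J) \<longrightarrow> finite (Arr J) \<longrightarrow> is_functor J C D \<longrightarrow>
        (\<exists>L p. is_limit J C D L p))"

definition is_terminal :: "('o, 'm) cat \<Rightarrow> 'o \<Rightarrow> bool" where
  "is_terminal C T \<longleftrightarrow> T \<in> Obj C \<and> (\<forall>A\<in>Obj C. \<exists>!t. in_hom C t A T)"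

definition is_product :: "('o, 'm) cat \<Rightarrow> 'o \<Rightarrow> 'o \<Rightarrow> 'm \<times> 'm \<Rightarrow> bool" where
  "is_product C A B p \<longleftrightarrow>
     (\<exists>W. in_hom C (fst p) W A \<and> in_hom C (snd p) W B \<and>
        (\<forall>Z a b. in_hom C a Z A \<longrightarrow> in_hom C b Z B \<longrightarrow>
           (\<exists>!m. in_hom C m Z W \<and> fst p \<cdot>\<^bsub>C\<^esub> m = a \<and> snd p \<cdot>\<^bsub>C\<^esub> m = b)))"

section \<open>Monomorphisms, regular epimorphisms and kernels\<close>

definition is_iso :: "('o, 'm) cat \<Rightarrow> 'm \<Rightarrow> bool" where
  "is_iso C f \<longleftrightarrow>
     (\<exists>A B g. in_hom C f A B \<and> in_hom C g B A \<and>
        g \<cdot>\<^bsub>C\<^esub> f = Ident C A \<and> f \<cdot>\<^bsub>C\<^esub> g = Ident C B)"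

definition is_mono :: "('o, 'm) cat \<Rightarrow> 'm \<Rightarrow> bool" where
  "is_mono C f \<longleftrightarrow> f \<in> Arr C \<and>
     (\<forall>Z a b. in_hom C a Z (Dom C f) \<longrightarrow> in_hom C b Z (Dom C f) \<longrightarrow>
        f \<cdot>\<^bsub>C\<^esub> a = f \<cdot>\<^bsub>C\<^esub> b \<longrightarrow> a = b)"

definition preserves_monos :: "('o, 'm) cat \<Rightarrow> ('o, 'm, 'o, 'm) ftor \<Rightarrow> bool" where
  "preserves_monos C H \<longleftrightarrow> (\<forall>f. is_mono C f \<longrightarrow> is_mono C (FArr H f))"

definition is_coequalizer :: "('o, 'm) cat \<Rightarrow> 'm \<times> 'm \<Rightarrow> 'm \<Rightarrow> bool" where
  "is_coequalizer C r k \<longleftrightarrow>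
     (\<exists>R X Y. in_hom C (fst r) R X \<and> in_hom C (snd r) R X \<and> in_hom C k X Y \<and>
        k \<cdot>\<^bsub>C\<^esub> fst r = k \<cdot>\<^bsub>C\<^esub> snd r \<and>
        (\<forall>Z g. in_hom C g X Z \<longrightarrow> g \<cdot>\<^bsub>C\<^esub> fst r = g \<cdot>\<^bsub>C\<^esub> snd r \<longrightarrow>
           (\<exists>!m. in_hom C m Y Z \<and> m \<cdot>\<^bsub>C\<^esub> k = g)))"

definition has_coequalizers :: "('o, 'm) cat \<Rightarrow> bool" where
  "has_coequalizers C \<longleftrightarrow>
     (\<forall>a b R X. in_hom C a R X \<longrightarrow> in_hom C b R X \<longrightarrow> (\<exists>k. is_coequalizer C (a, b) k))"

definition regular_epi :: "('o, 'm) cat \<Rightarrow> 'm \<Rightarrow> bool" where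
  "regular_epi C e \<longleftrightarrow> (\<exists>r. is_coequalizer C r e)"

definition regular_epis_compose :: "('o, 'm) cat \<Rightarrow> bool" where
  "regular_epis_compose C \<longleftrightarrow>
     (\<forall>e d. regular_epi C e \<longrightarrow> regular_epi C d \<longrightarrow> Cod C e = Dom C d \<longrightarrow>
        regular_epi C (d \<cdot>\<^bsub>C\<^esub> e))"

text \<open>A subobject of \<open>X \<times> X\<close> is represented by the pair of components \<open>R \<rightarrow> X\<close> of a monomorphism
  \<open>R \<rightarrow> X \<times> X\<close>; kernels are defined only up to isomorphism, so \<open>is_kernel\<close> is a relation.\<close>

definition is_kernel :: "('o, 'm) cat \<Rightarrow> 'm \<Rightarrow> 'm \<times> 'm \<Rightarrow> bool" where
  "is_kernel C f r \<longleftrightarrow> f \<in> Arr C \<and>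
     (\<exists>R. in_hom C (fst r) R (Dom C f) \<and> in_hom C (snd r) R (Dom C f) \<and>
        f \<cdot>\<^bsub>C\<^esub> fst r = f \<cdot>\<^bsub>C\<^esub> snd r \<and>
        (\<forall>Z a b. in_hom C a Z (Dom C f) \<longrightarrow> in_hom C b Z (Dom C f) \<longrightarrow>
           f \<cdot>\<^bsub>C\<^esub> a = f \<cdot>\<^bsub>C\<^esub> b \<longrightarrow>
           (\<exists>!m. in_hom C m Z R \<and> fst r \<cdot>\<^bsub>C\<^esub> m = a \<and> snd r \<cdot>\<^bsub>C\<^esub> m = b)))"

definition finer :: "('o, 'm) cat \<Rightarrow> 'm \<times> 'm \<Rightarrow> 'm \<times> 'm \<Rightarrow> bool" where
  "finer C r s \<longleftrightarrow>
     (\<exists>m. in_hom C m (Dom C (fst r)) (Dom C (fst s)) \<and>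
        fst s \<cdot>\<^bsub>C\<^esub> m = fst r \<and> snd s \<cdot>\<^bsub>C\<^esub> m = snd r)"

text \<open>Equality of subobjects.\<close>

definition same_subobject :: "('o, 'm) cat \<Rightarrow> 'm \<times> 'm \<Rightarrow> 'm \<times> 'm \<Rightarrow> bool" where
  "same_subobject C r s \<longleftrightarrow> finer C r s \<and> finer C s r"

definition properly_finer :: "('o, 'm) cat \<Rightarrow> 'm \<times> 'm \<Rightarrow> 'm \<times> 'm \<Rightarrow> bool" where
  "properly_finer C r s \<longleftrightarrow> finer C r s \<and> \<not> same_subobject C r s"

definition obj_quotients :: "('o, 'm) cat \<Rightarrow> 'o \<Rightarrow> 'm set" where
  "obj_quotients C X = {e. regular_epi C e \<and> Dom C e = X}"

definition quotient_equiv :: "('o, 'm) cat \<Rightarrow> 'o \<Rightarrow> ('m \<times> 'm) set" where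
  "quotient_equiv C X =
     {(d, e). d \<in> obj_quotients C X \<and> e \<in> obj_quotients C X \<and>
        (\<exists>i. is_iso C i \<and> in_hom C i (Cod C d) (Cod C e) \<and> i \<cdot>\<^bsub>C\<^esub> d = e)}"

text \<open>These are the quotients of the object \<open>X\<close>, to be used for the carrier of a coalgebra.
  Finiteness of the set of quotients carried by coalgebra morphisms would not make partition
  refinement terminate: for \<open>H Y = 2 \<times> Y\<close> on sets, the coalgebra \<open>n \<mapsto> (n = 0, n - 1)\<close> on the
  natural numbers (with \<open>0 - 1 = 0\<close>) is simple, but refining with \<open>select(y, z) = id\<close> splits off
  one state per iteration forever.\<close>

definition finitely_many_quotients :: "('o, 'm) cat \<Rightarrow> 'o \<Rightarrow> bool" where
  "finitely_many_quotients C X \<longleftrightarrow> finite (obj_quotients C X // quotient_equiv C X)"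

section \<open>Coalgebras\<close>

definition is_coalgebra :: "('o, 'm) cat \<Rightarrow> ('o, 'm, 'o, 'm) ftor \<Rightarrow> 'o \<times> 'm \<Rightarrow> bool" where
  "is_coalgebra C H A \<longleftrightarrow> fst A \<in> Obj C \<and> in_hom C (snd A) (fst A) (FObj H (fst A))"

definition coalgebra_hom ::
  "('o, 'm) cat \<Rightarrow> ('o, 'm, 'o, 'm) ftor \<Rightarrow> 'o \<times> 'm \<Rightarrow> 'o \<times> 'm \<Rightarrow> 'm \<Rightarrow> bool" where
  "coalgebra_hom C H A B h \<longleftrightarrow>
     is_coalgebra C H A \<and> is_coalgebra C H B \<and> in_hom C h (fst A) (fst B) \<and>
     snd B \<cdot>\<^bsub>C\<^esub> h = FArr H h \<cdot>\<^bsub>C\<^esub> snd A"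

definition coalgebra_quotient ::
  "('o, 'm) cat \<Rightarrow> ('o, 'm, 'o, 'm) ftor \<Rightarrow> 'o \<times> 'm \<Rightarrow> 'o \<times> 'm \<Rightarrow> 'm \<Rightarrow> bool" where
  "coalgebra_quotient C H A B h \<longleftrightarrow> coalgebra_hom C H A B h \<and> regular_epi C h"

definition coalgebra_iso ::
  "('o, 'm) cat \<Rightarrow> ('o, 'm, 'o, 'm) ftor \<Rightarrow> 'o \<times> 'm \<Rightarrow> 'o \<times> 'm \<Rightarrow> 'm \<Rightarrow> bool" where
  "coalgebra_iso C H A B h \<longleftrightarrow>
     coalgebra_hom C H A B h \<and>
     (\<exists>g. coalgebra_hom C H B A g \<and>
        g \<cdot>\<^bsub>C\<^esub> h = Ident C (fst A) \<and> h \<cdot>\<^bsub>C\<^esub> g = Ident C (fst B))"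

definition simple_coalgebra ::
  "('o, 'm) cat \<Rightarrow> ('o, 'm, 'o, 'm) ftor \<Rightarrow> 'o \<times> 'm \<Rightarrow> bool" where
  "simple_coalgebra C H A \<longleftrightarrow>
     is_coalgebra C H A \<and>
     (\<forall>B h. coalgebra_quotient C H A B h \<longrightarrow> coalgebra_iso C H A B h)"

definition simple_quotient ::
  "('o, 'm) cat \<Rightarrow> ('o, 'm, 'o, 'm) ftor \<Rightarrow> 'o \<times> 'm \<Rightarrow> 'o \<times> 'm \<Rightarrow> 'm \<Rightarrow> bool" where
  "simple_quotient C H A B h \<longleftrightarrow> coalgebra_quotient C H A B h \<and> simple_coalgebra C H B"

section \<open>Select routines\<close>

definition regular_epi_chain :: "('o, 'm) cat \<Rightarrow> 'm \<Rightarrow> 'm \<Rightarrow> bool" where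
  "regular_epi_chain C y z \<longleftrightarrow> regular_epi C y \<and> regular_epi C z \<and> Cod C y = Dom C z"

definition select_routine :: "('o, 'm) cat \<Rightarrow> ('m \<Rightarrow> 'm \<Rightarrow> 'm) \<Rightarrow> bool" where
  "select_routine C sel \<longleftrightarrow>
     (\<forall>y z. regular_epi_chain C y z \<longrightarrow> sel y z \<in> Arr C \<and> Dom C (sel y z) = Cod C y)"

definition discarding_at :: "('o, 'm) cat \<Rightarrow> ('m \<Rightarrow> 'm \<Rightarrow> 'm) \<Rightarrow> 'm \<Rightarrow> 'm \<Rightarrow> bool" where
  "discarding_at C sel y z \<longleftrightarrow>
     (\<exists>g. in_hom C g (Cod C z) (Cod C (sel y z)) \<and> sel y z = g \<cdot>\<^bsub>C\<^esub> z)"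

definition progressing :: "('o, 'm) cat \<Rightarrow> ('m \<Rightarrow> 'm \<Rightarrow> 'm) \<Rightarrow> bool" where
  "progressing C sel \<longleftrightarrow>
     (\<forall>y z. regular_epi_chain C y z \<longrightarrow> discarding_at C sel y z \<longrightarrow> is_iso C z)"

section \<open>Categorical partition refinement\<close>

text \<open>The state after \<open>i\<close> iterations consists of \<open>\<langle>q\<^sub>0, \<dots>, q\<^sub>i\<rangle> : X \<rightarrow> \<Prod>\<^sub>j\<^sub>\<le>\<^sub>i K\<^sub>j\<close> and
  representatives of \<open>P\<^sub>i\<close> and \<open>Q\<^sub>i\<close>. The terminal object, products, kernels and coequalizers used
  in a run are unique up to isomorphism only, and \<open>select\<close> need not respect isomorphisms. The
  algorithm is therefore a transition system in which every choice of representatives is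
  allowed at each iteration; statements about all runs hold whichever choices are made.\<close>

record 'm pr_state =
  qbar :: 'm
  Pker :: "'m \<times> 'm"
  Qker :: "'m \<times> 'm"

definition pr_init ::
  "('o, 'm) cat \<Rightarrow> ('o, 'm, 'o, 'm) ftor \<Rightarrow> 'o \<times> 'm \<Rightarrow> 'm pr_state \<Rightarrow> bool" where
  "pr_init C H A s \<longleftrightarrow>
     (\<exists>T. is_terminal C T \<and> in_hom C (qbar s) (fst A) T) \<and>
     is_product C (fst A) (fst A) (Qker s) \<and>
     is_kernel C (FArr H (qbar s) \<cdot>\<^bsub>C\<^esub> snd A) (Pker s)"

definition pr_running :: "('o, 'm) cat \<Rightarrow> 'm pr_state \<Rightarrow> bool" where
  "pr_running C s \<longleftrightarrow> properly_finer C (Pker s) (Qker s)"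

text \<open>The product \<open>\<Prod>\<^sub>j\<^sub>\<le>\<^sub>i\<^sub>+\<^sub>1 K\<^sub>j\<close> is formed as a product of \<open>\<Prod>\<^sub>j\<^sub>\<le>\<^sub>i K\<^sub>j\<close> (the codomain of \<open>qbar s\<close>)
  and \<open>K\<^sub>i\<^sub>+\<^sub>1\<close> (the codomain of \<open>q\<close>).\<close>

definition pr_step ::
  "('o, 'm) cat \<Rightarrow> ('o, 'm, 'o, 'm) ftor \<Rightarrow> ('m \<Rightarrow> 'm \<Rightarrow> 'm) \<Rightarrow> 'o \<times> 'm \<Rightarrow>
     'm pr_state \<Rightarrow> 'm pr_state \<Rightarrow> bool" where
  "pr_step C H sel A s s' \<longleftrightarrow>
     pr_running C s \<and>
     (\<exists>kP kQ f q p.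
        is_coequalizer C (Pker s) kP \<and> is_coequalizer C (Qker s) kQ \<and>
        in_hom C f (Cod C kP) (Cod C kQ) \<and> f \<cdot>\<^bsub>C\<^esub> kP = kQ \<and>
        q = sel kP f \<cdot>\<^bsub>C\<^esub> kP \<and>
        is_product C (Cod C (qbar s)) (Cod C q) p \<and>
        in_hom C (qbar s') (fst A) (Dom C (fst p)) \<and>
        fst p \<cdot>\<^bsub>C\<^esub> qbar s' = qbar s \<and> snd p \<cdot>\<^bsub>C\<^esub> qbar s' = q) \<and>
     is_kernel C (qbar s') (Qker s') \<and>
     is_kernel C (FArr H (qbar s') \<cdot>\<^bsub>C\<^esub> snd A) (Pker s')"

definition pr_reachable ::
  "('o, 'm) cat \<Rightarrow> ('o, 'm, 'o, 'm) ftor \<Rightarrow> ('m \<Rightarrow> 'm \<Rightarrow> 'm) \<Rightarrow> 'o \<times> 'm \<Rightarrow>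
     'm pr_state \<Rightarrow> bool" where
  "pr_reachable C H sel A s \<longleftrightarrow> (\<exists>s0. pr_init C H A s0 \<and> (pr_step C H sel A)\<^sup>*\<^sup>* s0 s)"

text \<open>The algorithm can start, never gets stuck inside the loop, leaves the loop only with equal
  subobjects \<open>P\<^sub>i\<close> and \<open>Q\<^sub>i\<close>, and has no infinite run.\<close>

definition pr_terminates ::
  "('o, 'm) cat \<Rightarrow> ('o, 'm, 'o, 'm) ftor \<Rightarrow> ('m \<Rightarrow> 'm \<Rightarrow> 'm) \<Rightarrow> 'o \<times> 'm \<Rightarrow> bool" where
  "pr_terminates C H sel A \<longleftrightarrow>
     (\<exists>s. pr_init C H A s) \<and>
     (\<forall>s. pr_reachable C H sel A s \<longrightarrow> pr_running C s \<longrightarrow> (\<exists>s'. pr_step C H sel A s s')) \<and>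
     (\<forall>s. pr_reachable C H sel A s \<longrightarrow> \<not> pr_running C s \<longrightarrow>
        same_subobject C (Pker s) (Qker s)) \<and>
     \<not> (\<exists>\<sigma> :: nat \<Rightarrow> 'm pr_state.
          pr_init C H A (\<sigma> 0) \<and> (\<forall>i. pr_step C H sel A (\<sigma> i) (\<sigma> (Suc i))))"

definition pr_computes_simple_quotient ::
  "('o, 'm) cat \<Rightarrow> ('o, 'm, 'o, 'm) ftor \<Rightarrow> ('m \<Rightarrow> 'm \<Rightarrow> 'm) \<Rightarrow> 'o \<times> 'm \<Rightarrow> bool" where
  "pr_computes_simple_quotient C H sel A \<longleftrightarrow>
     (\<forall>s k. pr_reachable C H sel A s \<longrightarrow> \<not> pr_running C s \<longrightarrow> is_coequalizer C (Qker s) k \<longrightarrow>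
        (\<exists>!z. coalgebra_hom C H A (Cod C k, z) k) \<and>
        (\<forall>z. coalgebra_hom C H A (Cod C k, z) k \<longrightarrow> simple_quotient C H A (Cod C k, z) k))"

end

theory Submission
  imports Defs
begin

text \<open>Call \<open>p\<close> finer than \<open>q\<close> (both with domain \<open>X\<close>) if \<open>p a = p b\<close> implies \<open>q a = q b\<close>; for kernels
  this is the order of subobjects. Every morphism is a monomorphism after the coequalizer of its
  kernel, because regular epimorphisms compose. One iteration yields
  \<open>P\<^sub>i\<^sub>+\<^sub>1 \<le> P\<^sub>i \<le> Q\<^sub>i\<^sub>+\<^sub>1 \<le> Q\<^sub>i\<close>, and \<open>Q\<^sub>i \<le> Q\<^sub>i\<^sub>+\<^sub>1\<close> would mean that \<open>select\<close> discards, hence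
  \<open>P\<^sub>i = Q\<^sub>i\<close>. So the \<open>Q\<^sub>i\<close> of a run are distinct kernels, and there are only finitely many of them.
  When \<open>P\<^sub>i = Q\<^sub>i\<close>, preservation of monomorphisms gives the coalgebra structure on \<open>X/Q\<^sub>i\<close>. It is
  simple because the kernel of every quotient coalgebra of \<open>X\<close> is below every \<open>Q\<^sub>i\<close>.\<close>

section \<open>Finite limits\<close>

text \<open>Every arrow is an identity, so composable arrows are equal and either one can serve as
  the composite.\<close>

definition discrete_cat :: "nat set \<Rightarrow> (nat, nat) cat" where
  "discrete_cat S = \<lparr>Obj = S, Arr = S, Dom = id, Cod = id, Ident = id, Comp = (\<lambda>g f. f)\<rparr>"

text \<open>The shape \<open>0 \<rightarrow> 2 \<leftarrow> 1\<close>: the identities are \<open>0\<close>, \<open>1\<close>, \<open>2\<close>, and the other arrows are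
  \<open>3 : 0 \<rightarrow> 2\<close> and \<open>4 : 1 \<rightarrow> 2\<close>.\<close>

definition cospan_cat :: "(nat, nat) cat" where
  "cospan_cat = \<lparr>Obj = {0, 1, 2}, Arr = {0, 1, 2, 3, 4},
     Dom = (\<lambda>u. if u = 3 then 0 else if u = 4 then 1 else u),
     Cod = (\<lambda>u. if u = 3 \<or> u = 4 then 2 else u),
     Ident = id, Comp = (\<lambda>g f. if f \<le> 2 then g else f)\<rparr>"

lemma discrete_category: "category (discrete_cat S)"
  by (rule category.intro) (auto simp: discrete_cat_def in_hom_def)

lemma cospan_category: "category cospan_cat"
  by (rule category.intro) (auto simp: cospan_cat_def in_hom_def split: if_splits)

context category
begin

section \<open>Terminal objects, products and kernel pairs as limits of finite diagrams\<close>

lemma in_homD: "in_hom C f A B \<Longrightarrow> A \<in> Obj C \<and> B \<in> Obj C"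
  using dom_in_Obj cod_in_Obj by (auto simp: in_hom_def)

text \<open>A terminal object is a limit of the empty diagram. There is nothing to map, hence
  \<open>undefined\<close> for the functor's values.\<close>

lemma terminal_exists:
  assumes "finitely_complete C"
  shows "\<exists>T. is_terminal C T"
proof -
  define D :: "(nat, nat, 'o, 'm) ftor" where "D = \<lparr>FObj = undefined, FArr = undefined\<rparr>"
  have "is_functor (discrete_cat {}) C D"
    by (auto simp: is_functor_def discrete_cat_def in_hom_def)
  then obtain L p where "is_limit (discrete_cat {}) C D L p"
    using assms discrete_category[of "{}"]
    by (force simp: finitely_complete_def discrete_cat_def)
  then have "is_terminal C L"
    by (auto simp: is_limit_def is_cone_def is_terminal_def discrete_cat_def in_hom_def)
  then show ?thesis ..
qed

lemma terminal_comp_eq: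
  assumes "is_terminal C T" "in_hom C t A T" "in_hom C a Z A" "in_hom C b Z A"
  shows "t \<cdot> a = t \<cdot> b"
  using assms(1) comp_in_hom[OF assms(3,2)] comp_in_hom[OF assms(4,2)] in_homD[OF assms(3)]
  unfolding is_terminal_def by blast

text \<open>Any two maps into \<open>A\<close> agree after \<open>t\<close>, so the universal
  property of the kernel of \<open>t\<close> becomes that of the product. Thus the initial
  \<open>Q_0 = X \<times> X\<close> is a kernel like all later \<open>Q_i\<close>.\<close>

lemma product_kernel_terminal:
  assumes "is_terminal C T" "in_hom C t A T" "is_product C A A p"
  shows "is_kernel C t p"
proof -
  note eq = terminal_comp_eq[OF assms(1,2)]
  have t: "t \<in> Arr C" "Dom C t = A"
    using assms(2) by (auto simp: in_hom_def)
  obtain W where W: "in_hom C (fst p) W A" "in_hom C (snd p) W A"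
    and u: "\<forall>Z a b. in_hom C a Z A \<longrightarrow> in_hom C b Z A \<longrightarrow>
       (\<exists>!m. in_hom C m Z W \<and> fst p \<cdot> m = a \<and> snd p \<cdot> m = b)"
    using assms(3) unfolding is_product_def by blast
  show ?thesis
    unfolding is_kernel_def t using t W u eq[OF W] by blast
qed

lemma product_exists:
  assumes "finitely_complete C" "A \<in> Obj C" "B \<in> Obj C"
  shows "\<exists>p. is_product C A B p"
proof -
  let ?J = "discrete_cat {0, 1}"
  define D :: "(nat, nat, 'o, 'm) ftor" where
    "D = \<lparr>FObj = (\<lambda>j. if j = 0 then A else B), FArr = (\<lambda>j. Ident C (if j = 0 then A else B))\<rparr>"
  have D: "FObj D 0 = A" "FObj D (Suc 0) = B" "FArr D 0 = Ident C A" "FArr D (Suc 0) = Ident C B"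
    by (simp_all add: D_def)
  have "is_functor ?J C D"
    using assms(2,3) ident_in_hom comp_ident_left[OF ident_in_hom]
    by (auto simp: is_functor_def discrete_cat_def in_hom_def D)
  then obtain L p where L: "is_limit ?J C D L p"
    using assms(1) discrete_category[of "{0, 1}"]
    by (force simp: finitely_complete_def discrete_cat_def)
  \<comment> \<open>The diagram has identity arrows only, so a cone is just a pair of
    arrows.\<close>
  have cone: "is_cone ?J C D Z t \<longleftrightarrow> in_hom C (t 0) Z A \<and> in_hom C (t (Suc 0)) Z B" for Z t
    using comp_ident_left in_homD
    by (auto simp: is_cone_def discrete_cat_def in_hom_def D)
  have "is_product C A B (p 0, p 1)"
    unfolding is_product_def
  proof (intro exI conjI allI impI; simp?)
    show "in_hom C (p 0) L A" "in_hom C (p (Suc 0)) L B"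
      using L cone by (auto simp: is_limit_def)
  next
    fix Z a b assume ab: "in_hom C a Z A" "in_hom C b Z B"
    define t where "t = (\<lambda>j::nat. if j = 0 then a else b)"
    have "is_cone ?J C D Z t"
      using ab cone[of Z t] by (simp add: t_def)
    then have "\<exists>!m. in_hom C m Z L \<and> (\<forall>j\<in>Obj ?J. p j \<cdot> m = t j)"
      using L by (auto simp: is_limit_def)
    then show "\<exists>!m. in_hom C m Z L \<and> p 0 \<cdot> m = a \<and> p (Suc 0) \<cdot> m = b"
      by (simp add: discrete_cat_def t_def)
  qed
  then show ?thesis ..
qed

text \<open>The kernel of \<open>f\<close> is the pullback of \<open>f\<close> along itself, a limit
  over the cospan with both legs equal to \<open>f\<close>.\<close>

lemma kernel_exists:
  assumes "finitely_complete C" "in_hom C f X Y"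
  shows "\<exists>r. is_kernel C f r"
proof -
  define D :: "(nat, nat, 'o, 'm) ftor" where
    "D = \<lparr>FObj = (\<lambda>j. if j = 2 then Y else X),
          FArr = (\<lambda>u. if u \<ge> 3 then f else Ident C (if u = 2 then Y else X))\<rparr>"
  have D: "FObj D 0 = X" "FObj D (Suc 0) = X" "FObj D 2 = Y"
    "FArr D 0 = Ident C X" "FArr D (Suc 0) = Ident C X" "FArr D 2 = Ident C Y"
    "FArr D 3 = f" "FArr D 4 = f"
    by (simp_all add: D_def)
  have XY: "X \<in> Obj C" "Y \<in> Obj C"
    using in_homD assms(2) by auto
  have ids: "Ident C X \<cdot> Ident C X = Ident C X" "Ident C Y \<cdot> Ident C Y = Ident C Y"
    "f \<cdot> Ident C X = f" "Ident C Y \<cdot> f = f"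
    using XY ident_in_hom comp_ident_left comp_ident_right assms(2) by blast+
  have "is_functor cospan_cat C D"
    using assms(2) XY ident_in_hom[of X] ident_in_hom[of Y]
    by (auto simp: is_functor_def cospan_cat_def in_hom_def D ids split: if_splits)
  then obtain L p where L: "is_limit cospan_cat C D L p"
    using assms(1) cospan_category
    by (force simp: finitely_complete_def cospan_cat_def)
  have cone: "is_cone cospan_cat C D Z t \<longleftrightarrow>
      in_hom C (t 0) Z X \<and> in_hom C (t (Suc 0)) Z X \<and> in_hom C (t 2) Z Y \<and>
      f \<cdot> t 0 = t 2 \<and> f \<cdot> t (Suc 0) = t 2" (is "_ \<longleftrightarrow> ?R") for Z t
  proof
    assume c: "is_cone cospan_cat C D Z t"
    have "in_hom cospan_cat 3 0 2" "in_hom cospan_cat 4 (Suc 0) 2"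
      by (auto simp: in_hom_def cospan_cat_def)
    then have "FArr D 3 \<cdot> t 0 = t 2" "FArr D 4 \<cdot> t (Suc 0) = t 2"
      using c by (auto simp: is_cone_def)
    moreover have "in_hom C (t 0) Z X \<and> in_hom C (t (Suc 0)) Z X \<and> in_hom C (t 2) Z Y"
      using c by (auto simp: is_cone_def cospan_cat_def D)
    ultimately show ?R
      by (simp add: D)
  next
    assume R: ?R
    have "Ident C X \<cdot> t 0 = t 0" "Ident C X \<cdot> t (Suc 0) = t (Suc 0)" "Ident C Y \<cdot> t 2 = t 2"
      using R comp_ident_left by blast+
    then have "FArr D u \<cdot> t j = t k" if "in_hom cospan_cat u j k" for u j k
      using that R by (auto simp: cospan_cat_def in_hom_def D split: if_splits)
    then show "is_cone cospan_cat C D Z t"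
      using R in_homD by (auto simp: is_cone_def cospan_cat_def D)
  qed
  have "is_kernel C f (p 0, p 1)"
    unfolding is_kernel_def
  proof (intro exI conjI allI impI; simp?)
    show "f \<in> Arr C"
      using assms(2) by (simp add: in_hom_def)
    show "in_hom C (p 0) L (Dom C f)" "in_hom C (p (Suc 0)) L (Dom C f)"
      "f \<cdot> p 0 = f \<cdot> p (Suc 0)"
      using L cone assms(2) by (auto simp: is_limit_def in_hom_def)
  next
    fix Z a b
    assume "in_hom C a Z (Dom C f)" "in_hom C b Z (Dom C f)" and eq: "f \<cdot> a = f \<cdot> b"
    then have ab: "in_hom C a Z X" "in_hom C b Z X"
      using assms(2) by (auto simp: in_hom_def)
    \<comment> \<open>The leg to the vertex \<open>2\<close> is forced to be
      \<open>f \<cdot> a\<close>, which equals \<open>f \<cdot> b\<close>.\<close>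
    define t where "t = (\<lambda>j::nat. if j = 0 then a else if j = 1 then b else f \<cdot> a)"
    have "is_cone cospan_cat C D Z t"
      using ab eq comp_in_hom assms(2) by (simp add: cone t_def)
    then have "\<exists>!m. in_hom C m Z L \<and> (\<forall>j\<in>Obj cospan_cat. p j \<cdot> m = t j)"
      using L by (auto simp: is_limit_def)
    \<comment> \<open>Agreement at \<open>2\<close> follows from agreement at \<open>0\<close>,
      because \<open>p 2 = f \<cdot> p 0\<close>; so uniqueness for cones becomes uniqueness for
      pairs.\<close>
    moreover have "(\<forall>j\<in>Obj cospan_cat. p j \<cdot> m = t j) \<longleftrightarrow> p 0 \<cdot> m = a \<and> p (Suc 0) \<cdot> m = b"
      if m: "in_hom C m Z L" for m
    proof -
      have p: "in_hom C (p 0) L X" "f \<cdot> p 0 = p 2"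
        using L cone by (auto simp: is_limit_def)
      then have "p 2 \<cdot> m = f \<cdot> (p 0 \<cdot> m)"
        using comp_assoc[OF m p(1) assms(2)] by simp
      then show ?thesis
        by (auto simp: cospan_cat_def t_def)
    qed
    ultimately show "\<exists>!m. in_hom C m Z L \<and> p 0 \<cdot> m = a \<and> p (Suc 0) \<cdot> m = b"
      by (smt (verit))
  qed
  then show ?thesis ..
qed

end

section \<open>The order of kernels\<close>

text \<open>Containment of kernels is tested on pairs of maps from an arbitrary \<open>Z\<close>, so
  no kernel has to be chosen. Membership in \<open>Arr C\<close> and the common domain are included
  so that transitivity has no side conditions.\<close>

definition ker_le :: "('o, 'm) cat \<Rightarrow> 'm \<Rightarrow> 'm \<Rightarrow> bool" where
  "ker_le C p q \<longleftrightarrow> p \<in> Arr C \<and> q \<in> Arr C \<and> Dom C p = Dom C q \<and>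
     (\<forall>Z a b. in_hom C a Z (Dom C p) \<longrightarrow> in_hom C b Z (Dom C p) \<longrightarrow>
        p \<cdot>\<^bsub>C\<^esub> a = p \<cdot>\<^bsub>C\<^esub> b \<longrightarrow> q \<cdot>\<^bsub>C\<^esub> a = q \<cdot>\<^bsub>C\<^esub> b)"

lemma ker_le_refl: "p \<in> Arr C \<Longrightarrow> ker_le C p p"
  by (simp add: ker_le_def)

lemma ker_le_trans [trans]: "ker_le C p q \<Longrightarrow> ker_le C q r \<Longrightarrow> ker_le C p r"
  unfolding ker_le_def by metis

lemma ker_leI:
  assumes "in_hom C p X A" "in_hom C q X B"
    and "\<And>Z a b. in_hom C a Z X \<Longrightarrow> in_hom C b Z X \<Longrightarrow> p \<cdot>\<^bsub>C\<^esub> a = p \<cdot>\<^bsub>C\<^esub> b \<Longrightarrow>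
      q \<cdot>\<^bsub>C\<^esub> a = q \<cdot>\<^bsub>C\<^esub> b"
  shows "ker_le C p q"
  using assms unfolding ker_le_def in_hom_def by metis

lemma ker_leD:
  assumes "ker_le C p q" "in_hom C a Z (Dom C p)" "in_hom C b Z (Dom C p)"
    "p \<cdot>\<^bsub>C\<^esub> a = p \<cdot>\<^bsub>C\<^esub> b"
  shows "q \<cdot>\<^bsub>C\<^esub> a = q \<cdot>\<^bsub>C\<^esub> b"
  using assms unfolding ker_le_def by blast

lemma ker_le_Dom: "ker_le C p q \<Longrightarrow> Dom C p = Dom C q"
  and ker_le_in_hom_left: "ker_le C p q \<Longrightarrow> in_hom C p (Dom C q) (Cod C p)"
  and ker_le_in_hom_right: "ker_le C p q \<Longrightarrow> in_hom C q (Dom C p) (Cod C q)"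
  unfolding ker_le_def in_hom_def by simp_all

context category
begin

lemma ker_le_comp:
  assumes "in_hom C p A B" "in_hom C g B D"
  shows "ker_le C p (g \<cdot> p)"
proof -
  have "in_hom C (g \<cdot> p) A D"
    using assms comp_in_hom by blast
  moreover have "(g \<cdot> p) \<cdot> a = g \<cdot> (p \<cdot> a)" if "in_hom C a Z A" for a Z
    using that assms comp_assoc by blast
  ultimately show ?thesis
    using assms by (intro ker_leI) auto
qed

text \<open>A pair identified by \<open>p\<close> factors through \<open>r\<close>, hence through
  \<open>s\<close>, whose components \<open>q\<close> identifies. Conversely, the components of
  \<open>r\<close> are identified by \<open>p\<close>, hence by \<open>q\<close>, and so factor
  through \<open>s\<close>.\<close>

lemma finer_iff_ker_le:
  assumes r: "is_kernel C p r" and s: "is_kernel C q s" and dom: "Dom C p = Dom C q"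
  shows "finer C r s \<longleftrightarrow> ker_le C p q"
proof -
  obtain R where R: "p \<in> Arr C" "in_hom C (fst r) R (Dom C p)" "in_hom C (snd r) R (Dom C p)"
    "p \<cdot> fst r = p \<cdot> snd r"
    and Ru: "\<And>Z a b. in_hom C a Z (Dom C p) \<Longrightarrow> in_hom C b Z (Dom C p) \<Longrightarrow> p \<cdot> a = p \<cdot> b \<Longrightarrow>
       \<exists>!m. in_hom C m Z R \<and> fst r \<cdot> m = a \<and> snd r \<cdot> m = b"
    using r unfolding is_kernel_def by blast
  obtain S where S: "q \<in> Arr C" "in_hom C (fst s) S (Dom C q)" "in_hom C (snd s) S (Dom C q)"
    "q \<cdot> fst s = q \<cdot> snd s"
    and Su: "\<And>Z a b. in_hom C a Z (Dom C q) \<Longrightarrow> in_hom C b Z (Dom C q) \<Longrightarrow> q \<cdot> a = q \<cdot> b \<Longrightarrow>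
       \<exists>!m. in_hom C m Z S \<and> fst s \<cdot> m = a \<and> snd s \<cdot> m = b"
    using s unfolding is_kernel_def by blast
  have q: "in_hom C q (Dom C q) (Cod C q)"
    using S(1) by (simp add: in_hom_def)
  have doms: "Dom C (fst r) = R" "Dom C (fst s) = S"
    using R S by (auto simp: in_hom_def)
  show ?thesis
  proof
    assume "finer C r s"
    then obtain m where m: "in_hom C m R S" "fst s \<cdot> m = fst r" "snd s \<cdot> m = snd r"
      by (auto simp: finer_def doms)
    have "q \<cdot> a = q \<cdot> b"
      if ab: "in_hom C a Z (Dom C p)" "in_hom C b Z (Dom C p)" "p \<cdot> a = p \<cdot> b" for Z a b
    proof -
      obtain n where n: "in_hom C n Z R" "fst r \<cdot> n = a" "snd r \<cdot> n = b"
        using Ru[OF ab] by blast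
      have mn: "in_hom C (m \<cdot> n) Z S"
        using n m comp_in_hom by blast
      have "a = fst s \<cdot> (m \<cdot> n)" "b = snd s \<cdot> (m \<cdot> n)"
        using n m comp_assoc[OF n(1) m(1) S(2)] comp_assoc[OF n(1) m(1) S(3)] by simp_all
      then show ?thesis
        using comp_assoc[OF mn S(2) q] comp_assoc[OF mn S(3) q] S(4) by metis
    qed
    then show "ker_le C p q"
      unfolding ker_le_def using R(1) S(1) dom by blast
  next
    assume "ker_le C p q"
    then have "q \<cdot> fst r = q \<cdot> snd r"
      using R unfolding ker_le_def by blast
    then show "finer C r s"
      using Su[of "fst r" R "snd r"] R dom by (auto simp: finer_def doms)
  qed
qed

section \<open>Monomorphisms, regular epimorphisms and quotients by kernels\<close>

lemma is_mono_cancel: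
  assumes "is_mono C m" "in_hom C m A B" "in_hom C a Z A" "in_hom C b Z A" "m \<cdot> a = m \<cdot> b"
  shows "a = b"
proof -
  have "Dom C m = A"
    using assms(2) by (simp add: in_hom_def)
  then show ?thesis
    using assms unfolding is_mono_def by blast
qed

lemma regular_epiD:
  assumes "regular_epi C e"
  shows "in_hom C e (Dom C e) (Cod C e)"
  using assms by (auto simp: regular_epi_def is_coequalizer_def in_hom_def)

lemma regular_epi_cancel:
  assumes e: "regular_epi C e" and m: "in_hom C m (Cod C e) Z" and n: "in_hom C n (Cod C e) Z"
    and eq: "m \<cdot> e = n \<cdot> e"
  shows "m = n"
proof -
  obtain r R X Y where r: "in_hom C (fst r) R X" "in_hom C (snd r) R X" and h: "in_hom C e X Y"
    "e \<cdot> fst r = e \<cdot> snd r"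
    and u: "\<And>Z g. in_hom C g X Z \<Longrightarrow> g \<cdot> fst r = g \<cdot> snd r \<Longrightarrow>
      \<exists>!m. in_hom C m Y Z \<and> m \<cdot> e = g"
    using e unfolding regular_epi_def is_coequalizer_def by blast
  have Y: "in_hom C m Y Z" "in_hom C n Y Z"
    using h m n by (auto simp: in_hom_def)
  have "(m \<cdot> e) \<cdot> fst r = (m \<cdot> e) \<cdot> snd r"
    using h(2) comp_assoc[OF r(1) h(1) Y(1)] comp_assoc[OF r(2) h(1) Y(1)] by metis
  then show ?thesis
    using u[OF comp_in_hom[OF h(1) Y(1)]] Y eq by metis
qed

text \<open>The pair of which \<open>e\<close> is the coequalizer is identified by \<open>e\<close>,
  hence by \<open>q\<close>; the universal property then supplies \<open>m\<close>.\<close>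

lemma regular_epi_factor:
  assumes e: "regular_epi C e" and le: "ker_le C e q"
  obtains m where "in_hom C m (Cod C e) (Cod C q)" "m \<cdot> e = q"
proof -
  obtain r R X Y where r: "in_hom C (fst r) R X" "in_hom C (snd r) R X" and h: "in_hom C e X Y"
    "e \<cdot> fst r = e \<cdot> snd r"
    and u: "\<And>Z g. in_hom C g X Z \<Longrightarrow> g \<cdot> fst r = g \<cdot> snd r \<Longrightarrow>
      \<exists>!m. in_hom C m Y Z \<and> m \<cdot> e = g"
    using e unfolding regular_epi_def is_coequalizer_def by blast
  have X: "Dom C e = X" "Cod C e = Y" "in_hom C q X (Cod C q)"
    using h ker_le_in_hom_right[OF le] by (simp_all add: in_hom_def)
  have "q \<cdot> fst r = q \<cdot> snd r"
    using ker_leD[OF le _ _ h(2)] r X(1) by blast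
  then show ?thesis
    using u[OF X(3)] that X by blast
qed

text \<open>Each of \<open>d\<close> and \<open>e\<close> factors through the other, and cancelling
  them on the right shows that the two factors are mutually inverse.\<close>

lemma regular_epi_ker_le_antisym:
  assumes d: "regular_epi C d" and e: "regular_epi C e"
    and "ker_le C d e" and "ker_le C e d"
    and g: "in_hom C g (Cod C d) (Cod C e)" "g \<cdot> d = e"
  shows "is_iso C g"
proof -
  obtain h where h: "in_hom C h (Cod C e) (Cod C d)" "h \<cdot> e = d"
    using regular_epi_factor[OF e assms(4)] .
  have hd: "in_hom C d (Dom C d) (Cod C d)" and he: "in_hom C e (Dom C e) (Cod C e)"
    using regular_epiD d e by blast+
  have "(h \<cdot> g) \<cdot> d = Ident C (Cod C d) \<cdot> d"
    using comp_assoc[OF hd g(1) h(1)] g h comp_ident_left[OF hd] by simp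
  then have 1: "h \<cdot> g = Ident C (Cod C d)"
    using regular_epi_cancel[OF d] comp_in_hom[OF g(1) h(1)] ident_in_hom in_homD[OF hd] by blast
  have "(g \<cdot> h) \<cdot> e = Ident C (Cod C e) \<cdot> e"
    using comp_assoc[OF he h(1) g(1)] g h comp_ident_left[OF he] by simp
  then have 2: "g \<cdot> h = Ident C (Cod C e)"
    using regular_epi_cancel[OF e] comp_in_hom[OF h(1) g(1)] ident_in_hom in_homD[OF he] by blast
  show ?thesis
    using 1 2 g(1) h(1) by (auto simp: is_iso_def)
qed

lemma ker_le_iso_comp:
  assumes i: "is_iso C i" "in_hom C i (Cod C d) B" and d: "in_hom C d A (Cod C d)"
  shows "ker_le C (i \<cdot> d) d"
proof -
  obtain j where j: "in_hom C j B (Cod C d)" "j \<cdot> i = Ident C (Cod C d)"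
    using i unfolding is_iso_def by (auto simp: in_hom_def)
  have "j \<cdot> (i \<cdot> d) = d"
    using comp_assoc[OF d i(2) j(1)] j(2) comp_ident_left[OF d] by simp
  then show ?thesis
    using ker_le_comp[OF comp_in_hom[OF d i(2)] j(1)] by simp
qed

text \<open>Pairs identified by \<open>p\<close> factor through \<open>r\<close>, which
  \<open>k\<close> coequalizes, and \<open>p\<close> itself factors through \<open>k\<close>. So
  passing from a map to the quotient by its kernel keeps the kernel.\<close>

lemma coequalizer_kernel:
  assumes r: "is_kernel C p r" and k: "is_coequalizer C r k"
  shows "regular_epi C k" "ker_le C p k" "ker_le C k p"
proof -
  show reg: "regular_epi C k"
    using k unfolding regular_epi_def ..
  obtain R where R: "p \<in> Arr C" "in_hom C (fst r) R (Dom C p)" "in_hom C (snd r) R (Dom C p)"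
    "p \<cdot> fst r = p \<cdot> snd r"
    and Ru: "\<And>Z a b. in_hom C a Z (Dom C p) \<Longrightarrow> in_hom C b Z (Dom C p) \<Longrightarrow> p \<cdot> a = p \<cdot> b \<Longrightarrow>
       \<exists>!m. in_hom C m Z R \<and> fst r \<cdot> m = a \<and> snd r \<cdot> m = b"
    using r unfolding is_kernel_def by blast
  obtain R' X Y where X: "in_hom C (fst r) R' X"
    and hX: "in_hom C k X Y" "k \<cdot> fst r = k \<cdot> snd r"
    and uX: "\<And>Z g. in_hom C g X Z \<Longrightarrow> g \<cdot> fst r = g \<cdot> snd r \<Longrightarrow>
      \<exists>!m. in_hom C m Y Z \<and> m \<cdot> k = g"
    using k unfolding is_coequalizer_def by blast
  have "X = Dom C p"
    using X R(2) by (simp add: in_hom_def)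
  note h = hX[unfolded this] and u = uX[unfolded this]
  have "k \<cdot> a = k \<cdot> b"
    if ab: "in_hom C a Z (Dom C p)" "in_hom C b Z (Dom C p)" "p \<cdot> a = p \<cdot> b" for Z a b
  proof -
    obtain n where n: "in_hom C n Z R" "fst r \<cdot> n = a" "snd r \<cdot> n = b"
      using Ru[OF ab] by blast
    then show ?thesis
      using comp_assoc[OF n(1) R(2) h(1)] comp_assoc[OF n(1) R(3) h(1)] h(2) by metis
  qed
  moreover have p: "in_hom C p (Dom C p) (Cod C p)"
    using R(1) by (simp add: in_hom_def)
  ultimately show "ker_le C p k"
    using h(1) by (blast intro: ker_leI)
  obtain m where "in_hom C m Y (Cod C p)" "m \<cdot> k = p"
    using u[OF p R(4)] by blast
  then show "ker_le C k p"
    using ker_le_comp[OF h(1)] by blast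
qed

text \<open>If \<open>e\<close> is the coequalizer of \<open>r\<close>, then \<open>g\<close> is
  that of the components of \<open>r\<close> followed by \<open>d\<close>: if \<open>m\<close>
  equalizes these, then \<open>m \<cdot> d\<close> factors through \<open>e = g \<cdot> d\<close>,
  and \<open>d\<close> cancels. This makes the connecting map from \<open>X/P\<close> to
  \<open>X/Q\<close> a legitimate argument of \<open>sel\<close>.\<close>

lemma regular_epi_second_factor:
  assumes d: "regular_epi C d" and e: "regular_epi C e"
    and g: "in_hom C g (Cod C d) (Cod C e)" "g \<cdot> d = e"
  shows "regular_epi C g"
proof -
  obtain r R X Y where r: "in_hom C (fst r) R X" "in_hom C (snd r) R X" and h: "in_hom C e X Y"
    "e \<cdot> fst r = e \<cdot> snd r"
    and u: "\<And>Z g. in_hom C g X Z \<Longrightarrow> g \<cdot> fst r = g \<cdot> snd r \<Longrightarrow>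
      \<exists>!m. in_hom C m Y Z \<and> m \<cdot> e = g"
    using e unfolding regular_epi_def is_coequalizer_def by blast
  have hd: "in_hom C d X (Cod C d)"
    using regular_epiD[OF d] h(1) comp_in_hom[OF regular_epiD[OF d] g(1)] g(2)
    by (auto simp: in_hom_def)
  have Y: "Cod C e = Y"
    using h by (simp add: in_hom_def)
  note gY = g(1)[unfolded Y]
  have assoc: "(m \<cdot> d) \<cdot> fst r = m \<cdot> (d \<cdot> fst r)" "(m \<cdot> d) \<cdot> snd r = m \<cdot> (d \<cdot> snd r)"
    if "in_hom C m (Cod C d) Z" for m Z
    using comp_assoc[OF r(1) hd that] comp_assoc[OF r(2) hd that] by auto
  have "is_coequalizer C (d \<cdot> fst r, d \<cdot> snd r) g"
    unfolding is_coequalizer_def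
  proof (intro exI conjI allI impI; simp?)
    show "in_hom C (d \<cdot> fst r) R (Cod C d)" "in_hom C (d \<cdot> snd r) R (Cod C d)"
      using r hd comp_in_hom by blast+
    show "in_hom C g (Cod C d) Y"
      using gY .
    show "g \<cdot> (d \<cdot> fst r) = g \<cdot> (d \<cdot> snd r)"
      using assoc[OF gY] g(2) h(2) by simp
  next
    fix Z m assume m: "in_hom C m (Cod C d) Z" and eq: "m \<cdot> (d \<cdot> fst r) = m \<cdot> (d \<cdot> snd r)"
    obtain n where n: "in_hom C n Y Z" "n \<cdot> e = m \<cdot> d"
      using u[OF comp_in_hom[OF hd m]] assoc[OF m] eq by metis
    have "(n \<cdot> g) \<cdot> d = m \<cdot> d"
      using comp_assoc[OF hd gY n(1)] n(2) g(2) by simp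
    then have ng: "n \<cdot> g = m"
      using regular_epi_cancel[OF d] comp_in_hom[OF gY n(1)] m by blast
    show "\<exists>!n. in_hom C n Y Z \<and> n \<cdot> g = m"
    proof (intro ex1I conjI)
      show "in_hom C n Y Z" "n \<cdot> g = m"
        using n ng by auto
      fix n' assume n': "in_hom C n' Y Z \<and> n' \<cdot> g = m"
      have "n' \<cdot> e = n \<cdot> e"
        using n' n comp_assoc[OF hd gY, of n'] g(2) by auto
      then show "n' = n"
        using regular_epi_cancel[OF e] n' n Y by blast
    qed
  qed
  then show ?thesis
    by (auto simp: regular_epi_def)
qed

text \<open>Let \<open>k'\<close> be the quotient by the kernel of \<open>m\<close>. The composite
  \<open>k' \<cdot> k\<close> is a regular epimorphism with kernel below that of
  \<open>m \<cdot> k\<close>, hence below that of \<open>k\<close>; so \<open>k\<close> factors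
  through it and \<open>k'\<close> gets a left inverse. Maps identified by \<open>m\<close> are
  identified by \<open>k'\<close> and are therefore equal.\<close>

lemma kernel_quotient_mono:
  assumes fc: "finitely_complete C" and coeq: "has_coequalizers C"
    and reg: "regular_epis_compose C"
    and k: "regular_epi C k" and m: "in_hom C m (Cod C k) B"
    and le: "ker_le C (m \<cdot> k) k"
  shows "is_mono C m"
proof -
  obtain s where s: "is_kernel C m s"
    using kernel_exists[OF fc m] by blast
  obtain k' where k': "is_coequalizer C s k'"
    using s coeq unfolding is_kernel_def has_coequalizers_def by (metis prod.collapse)
  note K = coequalizer_kernel[OF s k']
  have hk: "in_hom C k (Dom C k) (Cod C k)"
    using regular_epiD[OF k] .
  have hk': "in_hom C k' (Cod C k) (Cod C k')"
    using ker_le_in_hom_right[OF K(2)] m by (simp add: in_hom_def)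
  have kk: "regular_epi C (k' \<cdot> k)"
    using reg k K(1) hk' unfolding regular_epis_compose_def in_hom_def by auto
  have hkk: "in_hom C (k' \<cdot> k) (Dom C k) (Cod C k')"
    using comp_in_hom[OF hk hk'] .
  obtain n where n: "in_hom C n (Cod C k') (Cod C m)" "n \<cdot> k' = m"
    using regular_epi_factor[OF K(1,3)] .
  have "m \<cdot> k = n \<cdot> (k' \<cdot> k)"
    using comp_assoc[OF hk hk' n(1)] n(2) by simp
  then have "ker_le C (k' \<cdot> k) (m \<cdot> k)"
    using ker_le_comp[OF hkk n(1)] by simp
  then have "ker_le C (k' \<cdot> k) k"
    using le by (rule ker_le_trans)
  then obtain g where g: "in_hom C g (Cod C k') (Cod C k)" "g \<cdot> (k' \<cdot> k) = k"
    using regular_epi_factor[OF kk] hkk by (metis in_hom_def)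
  have "(g \<cdot> k') \<cdot> k = Ident C (Cod C k) \<cdot> k"
    using comp_assoc[OF hk hk' g(1)] g(2) comp_ident_left[OF hk] by simp
  then have gk: "g \<cdot> k' = Ident C (Cod C k)"
    using regular_epi_cancel[OF k] comp_in_hom[OF hk' g(1)] ident_in_hom in_homD[OF hk] by blast
  have "a = b" if ab: "in_hom C a Z (Cod C k)" "in_hom C b Z (Cod C k)" "m \<cdot> a = m \<cdot> b" for Z a b
  proof -
    have "k' \<cdot> a = k' \<cdot> b"
      using ker_leD[OF K(2) _ _ ab(3)] ab(1,2) m by (simp add: in_hom_def)
    then have "(g \<cdot> k') \<cdot> a = (g \<cdot> k') \<cdot> b"
      using comp_assoc[OF ab(1) hk' g(1)] comp_assoc[OF ab(2) hk' g(1)] by metis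
    then show ?thesis
      using gk ab comp_ident_left by metis
  qed
  moreover have "m \<in> Arr C" "Dom C m = Cod C k"
    using m by (simp_all add: in_hom_def)
  ultimately show ?thesis
    unfolding is_mono_def by metis
qed

end

section \<open>Runs of partition refinement\<close>

locale partition_refinement = category C for C :: "('o, 'm) cat" (structure) +
  fixes H :: "('o, 'm, 'o, 'm) ftor"
    and sel :: "'m \<Rightarrow> 'm \<Rightarrow> 'm"
    and X :: 'o
    and \<xi> :: 'm
  assumes finitely_complete: "finitely_complete C"
    and coequalizers: "has_coequalizers C"
    and regular_epis_compose: "regular_epis_compose C"
    and H_functor: "is_functor C C H"
    and preserves_monos: "preserves_monos C H"
    and coalgebra: "is_coalgebra C H (X, \<xi>)"
    and select: "select_routine C sel"
    and progressing: "progressing C sel"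
    and finitely_many: "finitely_many_quotients C X"
begin

section \<open>Maps out of the carrier, and the loop invariant\<close>

lemma X_Obj: "X \<in> Obj C" and \<xi>: "in_hom C \<xi> X (FObj H X)"
  using coalgebra by (auto simp: is_coalgebra_def)

lemma FArr_in_hom: "in_hom C f A B \<Longrightarrow> in_hom C (FArr H f) (FObj H A) (FObj H B)"
  using H_functor unfolding is_functor_def by blast

lemma FArr_comp:
  "in_hom C f A B \<Longrightarrow> in_hom C g B D \<Longrightarrow> FArr H (g \<cdot> f) = FArr H g \<cdot> FArr H f"
  using H_functor unfolding is_functor_def by blast

text \<open>For \<open>q = qbar s\<close> the kernel of this map is \<open>P\<close>.\<close>

definition next_map :: "'m \<Rightarrow> 'm" where
  "next_map q = FArr H q \<cdot> \<xi>"

lemma next_map_in_hom: "in_hom C q X K \<Longrightarrow> in_hom C (next_map q) X (FObj H K)"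
  using comp_in_hom[OF \<xi>] FArr_in_hom by (simp add: next_map_def)

lemma next_map_comp:
  assumes "in_hom C q X K" "in_hom C g K L"
  shows "next_map (g \<cdot> q) = FArr H g \<cdot> next_map q"
  using comp_assoc[OF \<xi> FArr_in_hom[OF assms(1)] FArr_in_hom[OF assms(2)]] FArr_comp[OF assms]
  by (simp add: next_map_def)

text \<open>The last conjunct says \<open>P \<le> Q\<close>, on which the existence of the
  connecting map from \<open>X/P\<close> to \<open>X/Q\<close> rests.\<close>

definition pr_inv :: "'m pr_state \<Rightarrow> bool" where
  "pr_inv s \<longleftrightarrow> in_hom C (qbar s) X (Cod C (qbar s)) \<and> is_kernel C (qbar s) (Qker s) \<and>
     is_kernel C (next_map (qbar s)) (Pker s) \<and> ker_le C (next_map (qbar s)) (qbar s)"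

lemma pr_inv_doms:
  assumes "pr_inv s"
  shows "Dom C (qbar s) = X" "Dom C (next_map (qbar s)) = X"
  using assms next_map_in_hom unfolding pr_inv_def in_hom_def by blast+

lemma pr_inv_finer: "pr_inv s \<Longrightarrow> finer C (Pker s) (Qker s)"
  using finer_iff_ker_le pr_inv_doms unfolding pr_inv_def by metis

text \<open>The invariant contains \<open>P \<le> Q\<close>, so being properly finer reduces to the
  failure of \<open>Q \<le> P\<close>.\<close>

lemma pr_running_iff:
  assumes "pr_inv s"
  shows "pr_running C s \<longleftrightarrow> \<not> ker_le C (qbar s) (next_map (qbar s))"
  using finer_iff_ker_le[of "qbar s" "Qker s" "next_map (qbar s)" "Pker s"] assms
    pr_inv_finer[OF assms] pr_inv_doms[OF assms]
  by (auto simp: pr_running_def properly_finer_def same_subobject_def pr_inv_def)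

lemma pr_init_inv:
  assumes "pr_init C H (X, \<xi>) s"
  shows "pr_inv s"
proof -
  obtain T where T: "is_terminal C T" "in_hom C (qbar s) X T"
    using assms by (auto simp: pr_init_def)
  have "ker_le C (next_map (qbar s)) (qbar s)"
    using next_map_in_hom[OF T(2)] T(2) terminal_comp_eq[OF T] by (intro ker_leI)
  then show ?thesis
    using T product_kernel_terminal[OF T] assms
    by (auto simp: pr_init_def pr_inv_def next_map_def in_hom_def)
qed

lemma pr_init_exists: "\<exists>s. pr_init C H (X, \<xi>) s"
proof -
  obtain T where T: "is_terminal C T"
    using terminal_exists[OF finitely_complete] ..
  then obtain t where t: "in_hom C t X T"
    using X_Obj by (auto simp: is_terminal_def)
  obtain p where p: "is_product C X X p"
    using product_exists[OF finitely_complete X_Obj X_Obj] ..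
  obtain r where r: "is_kernel C (next_map t) r"
    using kernel_exists[OF finitely_complete next_map_in_hom[OF t]] ..
  have "pr_init C H (X, \<xi>) \<lparr>qbar = t, Pker = r, Qker = p\<rparr>"
    using T t p r by (auto simp: pr_init_def next_map_def)
  then show ?thesis ..
qed

section \<open>A single iteration\<close>

lemma kernel_coequalizer_exists: "is_kernel C p r \<Longrightarrow> \<exists>k. is_coequalizer C r k"
  using coequalizers unfolding is_kernel_def has_coequalizers_def by (metis prod.collapse)

lemma pr_quotients:
  assumes inv: "pr_inv s"
    and kP: "is_coequalizer C (Pker s) kP" and kQ: "is_coequalizer C (Qker s) kQ"
  shows "regular_epi C kP" "regular_epi C kQ" "in_hom C kP X (Cod C kP)" "in_hom C kQ X (Cod C kQ)"
    "ker_le C kP kQ"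
    "ker_le C kP (next_map (qbar s))" "ker_le C (next_map (qbar s)) kP"
    "ker_le C kQ (qbar s)" "ker_le C (qbar s) kQ"
proof -
  have P: "is_kernel C (next_map (qbar s)) (Pker s)" and Q: "is_kernel C (qbar s) (Qker s)"
    and le: "ker_le C (next_map (qbar s)) (qbar s)"
    using inv by (auto simp: pr_inv_def)
  note cP = coequalizer_kernel[OF P kP] and cQ = coequalizer_kernel[OF Q kQ]
  show "regular_epi C kP" "regular_epi C kQ"
    "ker_le C kP (next_map (qbar s))" "ker_le C (next_map (qbar s)) kP"
    "ker_le C kQ (qbar s)" "ker_le C (qbar s) kQ"
    by (fact cP cQ)+
  show "in_hom C kP X (Cod C kP)" "in_hom C kQ X (Cod C kQ)"
    using ker_le_in_hom_right[OF cP(2)] ker_le_in_hom_right[OF cQ(2)] pr_inv_doms[OF inv] by simp_all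
  show "ker_le C kP kQ"
    using cP(3) le cQ(2) ker_le_trans by metis
qed

lemma pr_select:
  assumes inv: "pr_inv s"
    and kP: "is_coequalizer C (Pker s) kP" and kQ: "is_coequalizer C (Qker s) kQ"
    and f: "in_hom C f (Cod C kP) (Cod C kQ)" "f \<cdot> kP = kQ"
  shows "regular_epi_chain C kP f"
    and "in_hom C (sel kP f) (Cod C kP) (Cod C (sel kP f))"
proof -
  note q = pr_quotients[OF inv kP kQ]
  show chain: "regular_epi_chain C kP f"
    using regular_epi_second_factor[OF q(1,2) f] q(1) f(1)
    by (auto simp: regular_epi_chain_def in_hom_def)
  show "in_hom C (sel kP f) (Cod C kP) (Cod C (sel kP f))"
    using select chain by (auto simp: select_routine_def in_hom_def)
qed

lemma pr_step_exists:
  assumes inv: "pr_inv s" and run: "pr_running C s"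
  shows "\<exists>s'. pr_step C H sel (X, \<xi>) s s'"
proof -
  have b: "in_hom C (qbar s) X (Cod C (qbar s))"
    using inv by (simp add: pr_inv_def)
  obtain kP kQ where k: "is_coequalizer C (Pker s) kP" "is_coequalizer C (Qker s) kQ"
    using kernel_coequalizer_exists inv unfolding pr_inv_def by blast
  note quot = pr_quotients[OF inv k]
  obtain f where f: "in_hom C f (Cod C kP) (Cod C kQ)" "f \<cdot> kP = kQ"
    using regular_epi_factor[OF quot(1,5)] .
  define q where "q = sel kP f \<cdot> kP"
  have q: "in_hom C q X (Cod C q)"
    using comp_in_hom[OF quot(3) pr_select(2)[OF inv k f]] by (simp add: q_def in_hom_def)
  obtain p where p: "is_product C (Cod C (qbar s)) (Cod C q) p"
    using product_exists[OF finitely_complete] in_homD[OF b] in_homD[OF q] by blast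
  then obtain W m where W: "in_hom C (fst p) W (Cod C (qbar s))"
    and m: "in_hom C m X W" "fst p \<cdot> m = qbar s" "snd p \<cdot> m = q"
    using b q unfolding is_product_def by blast
  obtain r r' where r: "is_kernel C m r" "is_kernel C (next_map m) r'"
    using kernel_exists[OF finitely_complete] m(1) next_map_in_hom[OF m(1)] by blast
  have "Dom C (fst p) = W"
    using W by (simp add: in_hom_def)
  then have m': "in_hom C m X (Dom C (fst p))"
    using m(1) by simp
  have "pr_step C H sel (X, \<xi>) s \<lparr>qbar = m, Pker = r', Qker = r\<rparr>"
    unfolding pr_step_def pr_state.select_convs fst_conv snd_conv
    using run k f q_def p m' m(2,3) r[unfolded next_map_def] by blast
  then show ?thesis ..
qed

text \<open>The kernel of the pairing \<open>qbar s'\<close> is the intersection of the kernels of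
  \<open>qbar s\<close> and \<open>q\<close>, and \<open>P\<close> is below both since
  \<open>q\<close> factors through \<open>kP\<close>. The last claim is where progress enters:
  without a new splitting \<open>sel\<close> would discard, the connecting map would be invertible
  and \<open>P = Q\<close>.\<close>

lemma pr_step_ker_le:
  assumes inv: "pr_inv s" and step: "pr_step C H sel (X, \<xi>) s s'"
  shows "pr_inv s'" "ker_le C (qbar s') (qbar s)" "ker_le C (next_map (qbar s)) (qbar s')"
    "\<not> ker_le C (qbar s) (qbar s')"
proof -
  obtain kP kQ f q p where k: "is_coequalizer C (Pker s) kP" "is_coequalizer C (Qker s) kQ"
    and f: "in_hom C f (Cod C kP) (Cod C kQ)" "f \<cdot> kP = kQ"
    and q: "q = sel kP f \<cdot> kP"
    and p: "is_product C (Cod C (qbar s)) (Cod C q) p"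
    and m: "in_hom C (qbar s') X (Dom C (fst p))"
      "fst p \<cdot> qbar s' = qbar s" "snd p \<cdot> qbar s' = q"
    and ker: "is_kernel C (qbar s') (Qker s')" "is_kernel C (next_map (qbar s')) (Pker s')"
    and run: "pr_running C s"
    using step unfolding pr_step_def next_map_def fst_conv snd_conv by blast
  note quot = pr_quotients[OF inv k] and sl = pr_select[OF inv k f]
  obtain W where W: "in_hom C (fst p) W (Cod C (qbar s))" "in_hom C (snd p) W (Cod C q)"
    and Wu: "\<And>Z a b. in_hom C a Z (Cod C (qbar s)) \<Longrightarrow> in_hom C b Z (Cod C q) \<Longrightarrow>
       \<exists>!m. in_hom C m Z W \<and> fst p \<cdot> m = a \<and> snd p \<cdot> m = b"
    using p unfolding is_product_def by blast
  have mW: "in_hom C (qbar s') X W"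
    using m(1) W(1) by (simp add: in_hom_def)
  have qhom: "in_hom C q X (Cod C q)"
    using comp_in_hom[OF quot(3) sl(2)] by (simp add: q in_hom_def)
  show le: "ker_le C (qbar s') (qbar s)"
    using ker_le_comp[OF mW W(1)] m(2) by simp
  have leq: "ker_le C (qbar s') q"
    using ker_le_comp[OF mW W(2)] m(3) by simp
  \<comment> \<open>The product projections are jointly monic, so what is below both components is
    below the pairing.\<close>
  have inf: "ker_le C g (qbar s')" if g: "ker_le C g (qbar s)" "ker_le C g q" for g
  proof -
    have "qbar s' \<cdot> a = qbar s' \<cdot> b"
      if ab: "in_hom C a Z (Dom C g)" "in_hom C b Z (Dom C g)" "g \<cdot> a = g \<cdot> b" for Z a b
    proof -
      have "Dom C g = X"
        using ker_le_Dom[OF g(2)] qhom by (simp add: in_hom_def)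
      note h = ab(1,2)[unfolded this]
      have "qbar s \<cdot> a = qbar s \<cdot> b" "q \<cdot> a = q \<cdot> b"
        using ker_leD[OF g(1) ab] ker_leD[OF g(2) ab] by auto
      then have "fst p \<cdot> (qbar s' \<cdot> a) = fst p \<cdot> (qbar s' \<cdot> b)"
        "snd p \<cdot> (qbar s' \<cdot> a) = snd p \<cdot> (qbar s' \<cdot> b)"
        using m comp_assoc[OF h(1) mW W(1)] comp_assoc[OF h(2) mW W(1)]
          comp_assoc[OF h(1) mW W(2)] comp_assoc[OF h(2) mW W(2)] by metis+
      then show ?thesis
        using Wu[OF comp_in_hom[OF comp_in_hom[OF h(2) mW] W(1)]
            comp_in_hom[OF comp_in_hom[OF h(2) mW] W(2)]]
          comp_in_hom[OF h(1) mW] comp_in_hom[OF h(2) mW] by metis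
    qed
    then show ?thesis
      using ker_le_in_hom_left[OF g(2)] ker_le_in_hom_left[OF leq] ker_le_Dom[OF g(2)]
      by (intro ker_leI) auto
  qed
  have "ker_le C (next_map (qbar s)) q"
    using ker_le_trans[OF quot(7)] ker_le_comp[OF quot(3) sl(2)] q by simp
  then show leP: "ker_le C (next_map (qbar s)) (qbar s')"
    using inv by (intro inf) (simp_all add: pr_inv_def)
  \<comment> \<open>Applying \<open>H\<close> to the first projection recovers the old
    \<open>next_map\<close> from the new one.\<close>
  have "ker_le C (next_map (qbar s')) (next_map (qbar s))"
    using ker_le_comp[OF next_map_in_hom[OF mW] FArr_in_hom[OF W(1)]]
      next_map_comp[OF mW W(1)] m(2) by simp
  then have "ker_le C (next_map (qbar s')) (qbar s')"
    using leP by (rule ker_le_trans)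
  then show "pr_inv s'"
    using ker mW by (auto simp: pr_inv_def in_hom_def)
  show "\<not> ker_le C (qbar s) (qbar s')"
  proof
    assume "ker_le C (qbar s) (qbar s')"
    then have "ker_le C kQ q"
      using quot(8) leq ker_le_trans by metis
    then obtain g where g: "in_hom C g (Cod C kQ) (Cod C q)" "g \<cdot> kQ = q"
      using regular_epi_factor[OF quot(2)] by blast
    have cod: "Cod C q = Cod C (sel kP f)"
      using comp_in_hom[OF quot(3) sl(2)] by (simp add: q in_hom_def)
    \<comment> \<open>Cancelling the epimorphism \<open>kP\<close> shows that
      \<open>sel kP f\<close> factors through \<open>f\<close>.\<close>
    have "(g \<cdot> f) \<cdot> kP = sel kP f \<cdot> kP"
      using comp_assoc[OF quot(3) f(1) g(1)] f(2) g(2) q by simp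
    then have "sel kP f = g \<cdot> f"
      using regular_epi_cancel[OF quot(1)] comp_in_hom[OF f(1) g(1)] sl(2) cod by metis
    then have "discarding_at C sel kP f"
      using g(1) f(1) cod by (auto simp: discarding_at_def in_hom_def)
    then have "is_iso C f"
      using progressing sl(1) by (auto simp: progressing_def)
    then have "ker_le C kQ kP"
      using ker_le_iso_comp f quot(3) by metis
    then have "ker_le C (qbar s) (next_map (qbar s))"
      using ker_le_trans quot(6,9) by metis
    then show False
      using run pr_running_iff[OF inv] by simp
  qed
qed

section \<open>Whole runs: termination and correctness\<close>

lemma pr_reachable_inv:
  assumes "pr_reachable C H sel (X, \<xi>) s"
  shows "pr_inv s"
proof -
  obtain s0 where "pr_init C H (X, \<xi>) s0" and "(pr_step C H sel (X, \<xi>))\<^sup>*\<^sup>* s0 s"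
    using assms by (auto simp: pr_reachable_def)
  from this(2,1) show ?thesis
    by (induction rule: rtranclp_induct) (auto intro: pr_init_inv pr_step_ker_le(1))
qed

text \<open>The \<open>Q_i\<close> decrease strictly, so the quotients \<open>X/Q_i\<close> lie in
  distinct classes, and the natural numbers would embed into a finite set.\<close>

lemma no_infinite_run:
  assumes init: "pr_init C H (X, \<xi>) (\<sigma> 0)" and step: "\<And>i. pr_step C H sel (X, \<xi>) (\<sigma> i) (\<sigma> (Suc i))"
  shows False
proof -
  have inv: "pr_inv (\<sigma> i)" for i
    by (induction i) (use init step pr_init_inv pr_step_ker_le(1) in blast)+
  have "\<exists>k. is_coequalizer C (Qker (\<sigma> i)) k" for i
    using kernel_coequalizer_exists inv[of i] unfolding pr_inv_def by blast
  then obtain k where k: "\<And>i. is_coequalizer C (Qker (\<sigma> i)) (k i)"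
    by metis
  have ker: "regular_epi C (k i)" "ker_le C (qbar (\<sigma> i)) (k i)" "ker_le C (k i) (qbar (\<sigma> i))" for i
    using coequalizer_kernel[OF _ k[of i]] inv[of i] by (auto simp: pr_inv_def)
  have hom: "in_hom C (k i) X (Cod C (k i))" for i
    using ker_le_in_hom_right[OF ker(2)] pr_inv_doms[OF inv] by metis
  have quot: "k i \<in> obj_quotients C X" for i
    using ker(1)[of i] hom[of i] by (simp add: obj_quotients_def in_hom_def)
  have mono: "ker_le C (qbar (\<sigma> (i + n))) (qbar (\<sigma> i))" for i n
  proof (induction n)
    case 0
    show ?case
      using inv[of i] by (simp add: ker_le_refl pr_inv_def in_hom_def)
  next
    case (Suc n)
    then show ?case
      using pr_step_ker_le(2)[OF inv step, of "i + n"] ker_le_trans by fastforce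
  qed
  \<comment> \<open>Since \<open>Q_j \<le> Q_{i+1}\<close>, this would yield
    \<open>Q_i \<le> Q_{i+1}\<close>, which a single step excludes.\<close>
  have strict: "\<not> ker_le C (qbar (\<sigma> i)) (qbar (\<sigma> j))" if "i < j" for i j
  proof
    assume "ker_le C (qbar (\<sigma> i)) (qbar (\<sigma> j))"
    also have "ker_le C (qbar (\<sigma> j)) (qbar (\<sigma> (Suc i)))"
      using mono[of "Suc i" "j - Suc i"] that by simp
    finally show False
      using pr_step_ker_le(4)[OF inv step] by simp
  qed
  \<comment> \<open>Reflexivity puts \<open>k j\<close> into its own class, so that equal classes
    relate \<open>k i\<close> to \<open>k j\<close>.\<close>
  have refl: "(k i, k i) \<in> quotient_equiv C X" for i
  proof -
    have "in_hom C (Ident C (Cod C (k i))) (Cod C (k i)) (Cod C (k i))"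
      using ident_in_hom in_homD[OF hom] by blast
    then show ?thesis
      using quot comp_ident_left hom[of i] unfolding quotient_equiv_def is_iso_def by blast
  qed
  define c where "c i = quotient_equiv C X `` {k i}" for i
  have distinct: "c i \<noteq> c j" if "i < j" for i j
  proof
    assume "c i = c j"
    then have "(k i, k j) \<in> quotient_equiv C X"
      using refl[of j] by (auto simp: c_def)
    then obtain g where "in_hom C g (Cod C (k i)) (Cod C (k j))" "g \<cdot> k i = k j"
      by (auto simp: quotient_equiv_def)
    then have "ker_le C (k i) (k j)"
      using ker_le_comp[OF hom] by metis
    then show False
      using strict[OF that] ker ker_le_trans by metis
  qed
  have "inj c"
    by (rule injI) (metis distinct nat_neq_iff)
  moreover have "range c \<subseteq> obj_quotients C X // quotient_equiv C X"
    using quot by (auto simp: c_def intro: quotientI)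
  ultimately show False
    using finitely_many infinite_UNIV_nat finite_subset finite_imageD
    unfolding finitely_many_quotients_def by blast
qed

text \<open>Induction along the run: if the kernel of \<open>h\<close> is below \<open>Q_i\<close>,
  the coalgebra square makes \<open>next_map (qbar s)\<close> factor through \<open>h\<close>, so
  that kernel is below \<open>P_i\<close>, and \<open>P_i \<le> Q_{i+1}\<close>.\<close>

lemma coalgebra_quotient_ker_le:
  assumes reach: "pr_reachable C H sel (X, \<xi>) s"
    and h: "coalgebra_quotient C H (X, \<xi>) B h"
  shows "ker_le C h (qbar s)"
proof -
  have hh: "in_hom C h X (fst B)" and \<zeta>: "in_hom C (snd B) (fst B) (FObj H (fst B))"
    and sq: "snd B \<cdot> h = next_map h" and reg: "regular_epi C h"
    using h by (auto simp: coalgebra_quotient_def coalgebra_hom_def is_coalgebra_def next_map_def)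
  have next_le: "ker_le C h (next_map q)" if le: "ker_le C h q" for q
  proof -
    obtain g where "in_hom C g (Cod C h) (Cod C q)" and q: "g \<cdot> h = q"
      using regular_epi_factor[OF reg le] .
    then have g: "in_hom C g (fst B) (Cod C q)"
      using hh by (simp add: in_hom_def)
    have "next_map q = FArr H g \<cdot> (snd B \<cdot> h)"
      using next_map_comp[OF hh g] q sq by simp
    also have "\<dots> = (FArr H g \<cdot> snd B) \<cdot> h"
      using comp_assoc[OF hh \<zeta> FArr_in_hom[OF g]] by simp
    finally show ?thesis
      using ker_le_comp[OF hh comp_in_hom[OF \<zeta> FArr_in_hom[OF g]]] by simp
  qed
  obtain s0 where init: "pr_init C H (X, \<xi>) s0"
    and steps: "(pr_step C H sel (X, \<xi>))\<^sup>*\<^sup>* s0 s"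
    using reach by (auto simp: pr_reachable_def)
  from steps have "pr_inv s \<and> ker_le C h (qbar s)"
  proof (induction rule: rtranclp_induct)
    case base
    obtain T where T: "is_terminal C T" "in_hom C (qbar s0) X T"
      using init by (auto simp: pr_init_def)
    show ?case
      using pr_init_inv[OF init] ker_leI[OF hh T(2)] terminal_comp_eq[OF T] by blast
  next
    case (step t u)
    then have "pr_inv t" "ker_le C h (qbar t)"
      by simp_all
    then show ?case
      using pr_step_ker_le(1,3)[OF _ step(2)] ker_le_trans[OF next_le] by simp
  qed
  then show ?thesis ..
qed

text \<open>Write \<open>qbar s = m \<cdot> k\<close> with \<open>m\<close> monic. Since
  \<open>FArr H m\<close> is monic, the kernel of \<open>next_map k\<close> contains
  \<open>P\<close>, which on termination is the kernel of \<open>k\<close>; so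
  \<open>next_map k\<close> factors through \<open>k\<close>, which gives the structure. For a
  quotient \<open>h\<close> of the result, \<open>h \<cdot> k\<close> is a coalgebra quotient of
  \<open>X\<close>, so its kernel is below \<open>Q\<close> and \<open>h\<close> is
  invertible.\<close>

lemma final_quotient:
  assumes reach: "pr_reachable C H sel (X, \<xi>) s" and stop: "\<not> pr_running C s"
    and k: "is_coequalizer C (Qker s) k"
  shows "\<exists>!z. coalgebra_hom C H (X, \<xi>) (Cod C k, z) k"
    and "coalgebra_hom C H (X, \<xi>) (Cod C k, z) k \<Longrightarrow> simple_quotient C H (X, \<xi>) (Cod C k, z) k"
proof -
  let ?q = "qbar s"
  have inv: "pr_inv s"
    using pr_reachable_inv[OF reach] .
  then have "is_kernel C ?q (Qker s)"
    by (simp add: pr_inv_def)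
  note ck = coequalizer_kernel[OF this k]
  have hk: "in_hom C k X (Cod C k)"
    using ker_le_in_hom_right[OF ck(2)] pr_inv_doms[OF inv] by simp
  have Y: "Cod C k \<in> Obj C"
    using in_homD[OF hk] by simp
  obtain m where m: "in_hom C m (Cod C k) (Cod C ?q)" "m \<cdot> k = ?q"
    using regular_epi_factor[OF ck(1,3)] .
  have "is_mono C m"
    using kernel_quotient_mono[OF finitely_complete coequalizers regular_epis_compose ck(1) m(1)]
      m(2) ck(2) by simp
  then have Hm: "is_mono C (FArr H m)"
    using preserves_monos by (simp add: preserves_monos_def)
  have hHm: "in_hom C (FArr H m) (FObj H (Cod C k)) (FObj H (Cod C ?q))"
    using FArr_in_hom[OF m(1)] .
  have hnk: "in_hom C (next_map k) X (FObj H (Cod C k))"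
    using next_map_in_hom[OF hk] .
  have nq: "next_map ?q = FArr H m \<cdot> next_map k"
    using next_map_comp[OF hk m(1)] m(2) by simp
  have "ker_le C (next_map ?q) (next_map k)"
  proof -
    have "next_map k \<cdot> a = next_map k \<cdot> b"
      if ab: "in_hom C a Z X" "in_hom C b Z X" "next_map ?q \<cdot> a = next_map ?q \<cdot> b" for Z a b
    proof -
      have "FArr H m \<cdot> (next_map k \<cdot> a) = FArr H m \<cdot> (next_map k \<cdot> b)"
        using ab(3) nq comp_assoc[OF ab(1) hnk hHm] comp_assoc[OF ab(2) hnk hHm] by metis
      then show ?thesis
        using is_mono_cancel[OF Hm hHm comp_in_hom[OF ab(1) hnk] comp_in_hom[OF ab(2) hnk]]
        by blast
    qed
    then show ?thesis
      using hnk comp_in_hom[OF hnk hHm] nq by (metis ker_leI)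
  qed
  moreover have "ker_le C ?q (next_map ?q)"
    using stop pr_running_iff[OF inv] by simp
  ultimately have "ker_le C k (next_map k)"
    using ck(3) ker_le_trans by metis
  then obtain z where z: "in_hom C z (Cod C k) (FObj H (Cod C k))" "z \<cdot> k = next_map k"
    using regular_epi_factor[OF ck(1)] hnk by (metis in_hom_def)
  have hom_iff: "coalgebra_hom C H (X, \<xi>) (Cod C k, z') k \<longleftrightarrow>
      in_hom C z' (Cod C k) (FObj H (Cod C k)) \<and> z' \<cdot> k = next_map k" for z'
    using coalgebra hk Y by (auto simp: coalgebra_hom_def is_coalgebra_def next_map_def)
  show "\<exists>!z. coalgebra_hom C H (X, \<xi>) (Cod C k, z) k"
    unfolding hom_iff using z regular_epi_cancel[OF ck(1)] by metis
  fix z assume hom: "coalgebra_hom C H (X, \<xi>) (Cod C k, z) k"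
  then have z: "in_hom C z (Cod C k) (FObj H (Cod C k))" "z \<cdot> k = next_map k"
    by (simp_all add: hom_iff)
  have coalg: "is_coalgebra C H (Cod C k, z)"
    using hom by (simp add: coalgebra_hom_def)
  have "coalgebra_iso C H (Cod C k, z) B h" if h: "coalgebra_quotient C H (Cod C k, z) B h" for B h
  proof -
    have hh: "in_hom C h (Cod C k) (fst B)" and \<zeta>: "in_hom C (snd B) (fst B) (FObj H (fst B))"
      and sq: "snd B \<cdot> h = FArr H h \<cdot> z" and reg: "regular_epi C h"
      and B: "is_coalgebra C H B" and homh: "coalgebra_hom C H (Cod C k, z) B h"
      using h by (auto simp: coalgebra_quotient_def coalgebra_hom_def is_coalgebra_def)
    have Bcod: "Cod C h = fst B" "Dom C h = Cod C k"
      using hh by (simp_all add: in_hom_def)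
    have hhk: "in_hom C (h \<cdot> k) X (fst B)"
      using comp_in_hom[OF hk hh] .
    have "snd B \<cdot> (h \<cdot> k) = (FArr H h \<cdot> z) \<cdot> k"
      using comp_assoc[OF hk hh \<zeta>] sq by simp
    also have "\<dots> = next_map (h \<cdot> k)"
      using comp_assoc[OF hk z(1) FArr_in_hom[OF hh]] z(2) next_map_comp[OF hk hh] by simp
    finally have "coalgebra_hom C H (X, \<xi>) B (h \<cdot> k)"
      using coalgebra B hhk by (simp add: coalgebra_hom_def next_map_def)
    moreover have rhk: "regular_epi C (h \<cdot> k)"
      using regular_epis_compose ck(1) reg Bcod by (auto simp: regular_epis_compose_def)
    ultimately have "ker_le C (h \<cdot> k) ?q"
      using coalgebra_quotient_ker_le[OF reach] by (simp add: coalgebra_quotient_def)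
    then have "ker_le C (h \<cdot> k) k"
      using ck(2) ker_le_trans by metis
    moreover have "ker_le C k (h \<cdot> k)"
      using ker_le_comp[OF hk hh] .
    moreover have "Cod C (h \<cdot> k) = fst B"
      using hhk by (simp add: in_hom_def)
    ultimately have "is_iso C h"
      using regular_epi_ker_le_antisym[OF ck(1) rhk] hh by simp
    then obtain g where g: "in_hom C g (fst B) (Cod C k)" "g \<cdot> h = Ident C (Cod C k)"
      "h \<cdot> g = Ident C (fst B)"
      unfolding is_iso_def using Bcod by (auto simp: in_hom_def)
    have Hg: "in_hom C (FArr H g) (FObj H (fst B)) (FObj H (Cod C k))"
      using FArr_in_hom[OF g(1)] .
    \<comment> \<open>The inverse \<open>g\<close> is a coalgebra morphism because both sides of its
      square become \<open>z\<close> after composition with the epimorphism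
      \<open>h\<close>.\<close>
    have "FArr H g \<cdot> FArr H h = Ident C (FObj H (Cod C k))"
      using FArr_comp[OF hh g(1)] g(2) H_functor Y by (simp add: is_functor_def)
    then have "FArr H g \<cdot> (FArr H h \<cdot> z) = z"
      using comp_assoc[OF z(1) FArr_in_hom[OF hh] Hg] comp_ident_left[OF z(1)] by simp
    then have "(FArr H g \<cdot> snd B) \<cdot> h = z"
      using comp_assoc[OF hh \<zeta> Hg] sq by simp
    moreover have "(z \<cdot> g) \<cdot> h = z"
      using comp_assoc[OF hh g(1) z(1)] g(2) comp_ident_right[OF z(1)] by simp
    ultimately have "z \<cdot> g = FArr H g \<cdot> snd B"
      using regular_epi_cancel[OF reg] comp_in_hom[OF g(1) z(1)] comp_in_hom[OF \<zeta> Hg] Bcod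
      by metis
    then have "coalgebra_hom C H B (Cod C k, z) g"
      using B coalg g(1) by (simp add: coalgebra_hom_def)
    then show ?thesis
      using homh g by (auto simp: coalgebra_iso_def)
  qed
  then show "simple_quotient C H (X, \<xi>) (Cod C k, z) k"
    using hom ck(1) coalg
    by (simp add: simple_quotient_def simple_coalgebra_def coalgebra_quotient_def)
qed

lemma terminates: "pr_terminates C H sel (X, \<xi>)"
  unfolding pr_terminates_def
proof (intro conjI allI impI)
  show "\<not> (\<exists>\<sigma>. pr_init C H (X, \<xi>) (\<sigma> 0) \<and> (\<forall>i. pr_step C H sel (X, \<xi>) (\<sigma> i) (\<sigma> (Suc i))))"
    using no_infinite_run by blast
next
  fix s
  assume "pr_reachable C H sel (X, \<xi>) s" "\<not> pr_running C s"
  \<comment> \<open>The invariant gives \<open>P \<le> Q\<close>, so leaving the loop can only mean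
    equality.\<close>
  then show "same_subobject C (Pker s) (Qker s)"
    using pr_inv_finer[OF pr_reachable_inv] by (simp add: pr_running_def properly_finer_def)
qed (use pr_init_exists pr_step_exists pr_reachable_inv in blast)+

lemma computes_simple_quotient: "pr_computes_simple_quotient C H sel (X, \<xi>)"
  unfolding pr_computes_simple_quotient_def using final_quotient by blast

end

theorem theorem4p20:
  fixes C :: "('o, 'm) cat"
    and H :: "('o, 'm, 'o, 'm) ftor"
    and sel :: "'m \<Rightarrow> 'm \<Rightarrow> 'm"
    and X :: 'o
    and \<xi> :: 'm
  assumes "category C"
    and "finitely_complete C"
    and "has_coequalizers C"
    and "regular_epis_compose C"
    and "is_functor C C H"
    and "preserves_monos C H"
    and "is_coalgebra C H (X, \<xi>)"
    and "select_routine C sel"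
    and "progressing C sel"
    and "finitely_many_quotients C X"
  shows "pr_terminates C H sel (X, \<xi>) \<and> pr_computes_simple_quotient C H sel (X, \<xi>)"
proof -
  interpret partition_refinement C H sel X \<xi>
    using assms by (simp add: partition_refinement_def partition_refinement_axioms_def)
  show ?thesis
    using terminates computes_simple_quotient ..
qed

end
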